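(* For any $0 \le \theta \le 1$, there is a probabilistic polynomial for the threshold function $\mathrm{TH}_\theta$ on $n$ bits, of degree $O(\sqrt{n \log s})$ and with error $1/s$, which can be randomly sampled using only $O(\log n \cdot \log(ns))$ random bits.
   Context: For $x=(x_1,\ldots,x_n)\in\{0,1\}^n$ let $|x|=\sum_i x_i$. For $\theta\in[0,1]$, the threshold function $\mathrm{TH}_\theta:\{0,1\}^n\to\{0,1\}$ is $\mathrm{TH}_\theta(x)=1$ iff $|x|/n\ge\theta$. If $f$ is a Boolean function on $n$ variables and $R$ a ring, a probabilistic polynomial for $f$ with error $1/s$ and degree $d$ is a distribution $\mathcal D$ over degree-$d$ polynomials over $R$ such that for every $x\in\{0,1\}^n$, $\Pr_{p\sim\mathcal D}[p(x)=f(x)]\ge 1-1/s$. "Sampled using $r$ random bits" means a polynomial from the distribution is obtained as a deterministic function of $r$ uniformly random bits. *)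

theory Defs
  imports
    "HOL-Probability.Probability_Mass_Function"
    "HOL-Library.Poly_Mapping"
begin

text \<open>Polynomials in variables indexed by \<open>nat\<close> (the variables \<open>x\<^sub>1, \<dots>, x\<^sub>n\<close> are numbered
  \<open>0, \<dots>, n - 1\<close>): finitely supported maps from exponent vectors to coefficients.\<close>

type_synonym 'a mpoly = "(nat \<Rightarrow>\<^sub>0 nat) \<Rightarrow>\<^sub>0 'a"

definition mpoly_vars :: "'a::zero mpoly \<Rightarrow> nat set" where
  "mpoly_vars p = (\<Union>m\<in>Poly_Mapping.keys p. Poly_Mapping.keys m)"

definition monom_degree :: "(nat \<Rightarrow>\<^sub>0 nat) \<Rightarrow> nat" where
  "monom_degree m = (\<Sum>i\<in>Poly_Mapping.keys m. Poly_Mapping.lookup m i)"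

text \<open>Total degree; the zero polynomial gets degree \<open>0\<close>.\<close>

definition total_degree :: "'a::zero mpoly \<Rightarrow> nat" where
  "total_degree p = Max (insert 0 (monom_degree ` Poly_Mapping.keys p))"

text \<open>The coefficient ring is not assumed commutative, so a monomial is evaluated as a product in
  increasing order of the variables. At the points with coordinates \<open>0\<close> and \<open>1\<close>, which are
  central, the order is immaterial.\<close>

definition mpoly_eval :: "'a::ring_1 mpoly \<Rightarrow> (nat \<Rightarrow> 'a) \<Rightarrow> 'a" where
  "mpoly_eval p v =
     (\<Sum>m\<in>Poly_Mapping.keys p. Poly_Mapping.lookup p m *
        prod_list (map (\<lambda>i. v i ^ Poly_Mapping.lookup m i) (sorted_list_of_set (Poly_Mapping.keys m))))"

definition bitstrings :: "nat \<Rightarrow> bool list set" where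
  "bitstrings n = {x. length x = n}"

definition bit_eval :: "'a::ring_1 mpoly \<Rightarrow> bool list \<Rightarrow> 'a" where
  "bit_eval p x = mpoly_eval p (\<lambda>i. of_bool (x ! i))"

definition TH :: "real \<Rightarrow> bool list \<Rightarrow> bool" where
  "TH \<theta> x \<longleftrightarrow> real (count_list x True) / real (length x) \<ge> \<theta>"

text \<open>\<open>D\<close> is a probabilistic polynomial for \<open>f\<close> on \<open>n\<close> bits with error \<open>\<epsilon>\<close> and degree \<open>d\<close>, where
  degree \<open>d\<close> means total degree at most \<open>d\<close>.\<close>

definition probabilistic_polynomial ::
  "nat \<Rightarrow> (bool list \<Rightarrow> bool) \<Rightarrow> real \<Rightarrow> nat \<Rightarrow> 'a::ring_1 mpoly pmf \<Rightarrow> bool" where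
  "probabilistic_polynomial n f \<epsilon> d D \<longleftrightarrow>
     (\<forall>p\<in>set_pmf D. mpoly_vars p \<subseteq> {..<n} \<and> total_degree p \<le> d) \<and>
     (\<forall>x\<in>bitstrings n. measure_pmf.prob D {p. bit_eval p x = of_bool (f x)} \<ge> 1 - \<epsilon>)"

definition sampled_by_bits :: "nat \<Rightarrow> 'b pmf \<Rightarrow> bool" where
  "sampled_by_bits r D \<longleftrightarrow> (\<exists>G. D = map_pmf G (pmf_of_set (bitstrings r)))"

end

theory Submission
  imports Defs "HOL-Probability.Hoeffding"
begin

text \<open>A threshold at \<open>t\<close> on \<open>n\<close> bits is reduced to two thresholds \<open>u, v\<close> at \<open>m t / n \<mp> \<delta>\<close> on
  \<open>m = n div 2\<close> bits sampled with replacement: off the rare event that the sample misjudges the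
  weight by \<open>\<delta>\<close>, either \<open>u = v\<close> already is the answer, or the weight is within
  \<open>2 \<delta> n / m = O(sqrt (n log (1 / \<epsilon>)))\<close> of \<open>t\<close> and an interpolating polynomial \<open>A\<close> in the weight is
  right. The combination \<open>v + (u - v) A\<close> is affine in \<open>u, v\<close>, so the recursion only adds
  \<open>deg A\<close> to the degree and the degrees form a geometric series. The number of random bits is
  irrelevant in this construction: by Newman's argument some fixed list of \<open>O(n s\<^sup>2)\<close> sampled
  polynomials, drawn from uniformly, still has error \<open>1 / s\<close>. Everything is done over the
  integers and mapped to the coefficient ring at the end.\<close>

section \<open>Integer multilinear polynomials as functions\<close>

abbreviation monomial_fun :: "nat set \<Rightarrow> bool list \<Rightarrow> int" where
  "monomial_fun S x \<equiv> of_bool (\<forall>i\<in>S. x ! i)"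

text \<open>Degree at most \<open>d\<close> is defined on functions, so that closure properties go
  by induction on the number of monomials. No length is imposed on the argument list; only its
  entries below \<open>n\<close> are read.\<close>

inductive multilinear :: "nat \<Rightarrow> nat \<Rightarrow> (bool list \<Rightarrow> int) \<Rightarrow> bool" for n d where
  zero: "multilinear n d (\<lambda>_. 0)"
| add_monomial: "multilinear n d f \<Longrightarrow> S \<subseteq> {..<n} \<Longrightarrow> card S \<le> d \<Longrightarrow>
    multilinear n d (\<lambda>x. f x + c * monomial_fun S x)"

lemma multilinear_monomial:
  assumes "S \<subseteq> {..<n}" "card S \<le> d"
  shows "multilinear n d (\<lambda>x. c * monomial_fun S x)"
  using add_monomial[OF zero assms] by simp

lemma multilinear_mono:
  assumes "multilinear n d f" "d \<le> e"
  shows "multilinear n e f"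
  using assms(1) by induction (use assms(2) in \<open>auto intro: multilinear.intros\<close>)

lemma multilinear_add:
  assumes "multilinear n d f" "multilinear n d g"
  shows "multilinear n d (\<lambda>x. f x + g x)"
  using assms(2)
proof induction
  case zero
  then show ?case using assms(1) by simp
next
  case (add_monomial g S c)
  then show ?case
    using multilinear.add_monomial[of n d "\<lambda>x. f x + g x" S c] by (simp add: add.assoc)
qed

lemma multilinear_scale:
  assumes "multilinear n d f"
  shows "multilinear n d (\<lambda>x. a * f x)"
  using assms
proof induction
  case zero
  then show ?case by (simp add: multilinear.zero)
next
  case (add_monomial f S c)
  then show ?case
    using multilinear.add_monomial[of n d "\<lambda>x. a * f x" S "a * c"]
    by (simp add: distrib_left mult.assoc)
qed

lemma multilinear_diff:
  assumes "multilinear n d f" "multilinear n d g"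
  shows "multilinear n d (\<lambda>x. f x - g x)"
  using multilinear_add[OF assms(1) multilinear_scale[OF assms(2), of "-1"]] by simp

lemma multilinear_sum:
  assumes "\<And>i. i \<in> A \<Longrightarrow> multilinear n d (f i)"
  shows "multilinear n d (\<lambda>x. \<Sum>i\<in>A. f i x)"
  using assms
  by (induction A rule: infinite_finite_induct)
     (auto intro!: multilinear_add multilinear.zero)

text \<open>Bits are idempotent, so the monomials of \<open>T\<close> and \<open>S\<close> multiply
  to that of \<open>T \<union> S\<close>, whose size is at most the sum of the sizes.\<close>

lemma multilinear_mult_monomial:
  assumes "multilinear n d f" "S \<subseteq> {..<n}" "card S \<le> e"
  shows "multilinear n (d + e) (\<lambda>x. f x * (c * monomial_fun S x))"
  using assms(1)
proof induction
  case zero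
  then show ?case by (simp add: multilinear.zero)
next
  case (add_monomial f T b)
  have "card (T \<union> S) \<le> d + e"
    using add_monomial assms(3) card_Un_le[of T S] by linarith
  then have "multilinear n (d + e)
      (\<lambda>x. f x * (c * monomial_fun S x) + (b * c) * monomial_fun (T \<union> S) x)"
    using add_monomial assms(2) by (intro multilinear.add_monomial) auto
  moreover have "(b * c) * monomial_fun (T \<union> S) x =
      b * monomial_fun T x * (c * monomial_fun S x)" for x
    by auto
  ultimately show ?case by (simp add: distrib_right)
qed

lemma multilinear_mult:
  assumes "multilinear n d f" "multilinear n e g"
  shows "multilinear n (d + e) (\<lambda>x. f x * g x)"
  using assms(2)
proof induction
  case zero
  then show ?case by (simp add: multilinear.zero)
next
  case (add_monomial g S c)
  then show ?case
    using multilinear_add[OF add_monomial.IH multilinear_mult_monomial[OF assms(1), of S e c]]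
    by (simp add: distrib_left)
qed

lemma multilinear_subst:
  assumes "multilinear m d f" "\<And>j. j < m \<Longrightarrow> \<sigma> j < n"
  shows "multilinear n d (\<lambda>x. f (map (\<lambda>j. x ! \<sigma> j) [0..<m]))"
  using assms(1)
proof induction
  case zero
  then show ?case by (simp add: multilinear.zero)
next
  case (add_monomial f S c)
  have "monomial_fun S (map (\<lambda>j. x ! \<sigma> j) [0..<m]) = monomial_fun (\<sigma> ` S) x" for x
    using add_monomial by (auto simp: subset_iff)
  moreover have "card (\<sigma> ` S) \<le> d" "\<sigma> ` S \<subseteq> {..<n}"
    using add_monomial assms(2) card_image_le[of S \<sigma>] finite_subset[of S "{..<m}"] by fastforce+
  ultimately show ?case
    using multilinear.add_monomial[OF add_monomial.IH, of "\<sigma> ` S" c] by simp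
qed

text \<open>The inductive definition may add the same set repeatedly. Collecting terms leaves one
  coefficient per set, as a formal polynomial requires.\<close>

lemma multilinear_coeffs:
  assumes "multilinear n d f"
  shows "\<exists>c. \<forall>x. f x = (\<Sum>S | S \<subseteq> {..<n} \<and> card S \<le> d. c S * monomial_fun S x)"
  using assms
proof induction
  case zero
  show ?case by (rule exI[of _ "\<lambda>_. 0"]) simp
next
  case (add_monomial f T b)
  let ?F = "{S. S \<subseteq> {..<n} \<and> card S \<le> d}"
  have fin: "finite ?F" by (rule finite_subset[of _ "Pow {..<n}"]) auto
  obtain c where c: "\<And>x. f x = (\<Sum>S\<in>?F. c S * monomial_fun S x)"
    using add_monomial by auto
  have "f x + b * monomial_fun T x =
      (\<Sum>S\<in>?F. (c S + (if S = T then b else 0)) * monomial_fun S x)" for x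
  proof -
    have "(\<Sum>S\<in>?F. (if S = T then b else 0) * monomial_fun S x) =
        (\<Sum>S\<in>?F. if S = T then b * monomial_fun T x else 0)"
      by (intro sum.cong) auto
    also have "\<dots> = b * monomial_fun T x"
      using fin add_monomial by (simp add: sum.delta')
    finally show ?thesis
      by (simp add: c distrib_right sum.distrib)
  qed
  then show ?case by (intro exI allI)
qed

section \<open>From functions to formal polynomials over a ring\<close>

definition set_exponent :: "nat set \<Rightarrow> (nat \<Rightarrow>\<^sub>0 nat)" where
  "set_exponent S = Abs_poly_mapping (\<lambda>i. of_bool (i \<in> S))"

lemma lookup_set_exponent:
  "finite S \<Longrightarrow> Poly_Mapping.lookup (set_exponent S) i = of_bool (i \<in> S)"
  unfolding set_exponent_def by (subst lookup_Abs_poly_mapping) auto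

lemma keys_set_exponent: "finite S \<Longrightarrow> Poly_Mapping.keys (set_exponent S) = S"
  by (auto simp: in_keys_iff lookup_set_exponent)

lemma monom_degree_set_exponent: "finite S \<Longrightarrow> monom_degree (set_exponent S) = card S"
  by (simp add: monom_degree_def keys_set_exponent lookup_set_exponent)

lemma prod_list_of_bool:
  "prod_list (map (\<lambda>i. of_bool (P i)) xs) = (of_bool (\<forall>i\<in>set xs. P i) :: 'a::ring_1)"
  by (induction xs) auto

lemma multilinear_mpoly:
  assumes "multilinear n d f"
  shows "\<exists>p :: 'a::ring_1 mpoly. mpoly_vars p \<subseteq> {..<n} \<and> total_degree p \<le> d \<and>
           (\<forall>x. bit_eval p x = of_int (f x))"
proof -
  define F where "F = {S. S \<subseteq> {..<n} \<and> card S \<le> d}"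
  have fin: "finite F" unfolding F_def by (rule finite_subset[of _ "Pow {..<n}"]) auto
  have F: "S \<subseteq> {..<n}" "card S \<le> d" "finite S" if "S \<in> F" for S
    using that finite_subset[of S "{..<n}"] by (auto simp: F_def)
  note finS = F(3)
  obtain c where c: "\<And>x. f x = (\<Sum>S\<in>F. c S * monomial_fun S x)"
    using multilinear_coeffs[OF assms] unfolding F_def by auto
  define p :: "'a mpoly" where
    "p = Abs_poly_mapping (\<lambda>m. if m \<in> set_exponent ` F then of_int (c (Poly_Mapping.keys m)) else 0)"
  have lookup: "Poly_Mapping.lookup p m =
      (if m \<in> set_exponent ` F then of_int (c (Poly_Mapping.keys m)) else 0)" for m
    unfolding p_def
    by (subst lookup_Abs_poly_mapping) (auto intro: finite_subset[OF _ finite_imageI[OF fin]])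
  \<comment> \<open>Only an inclusion: a nonzero integer coefficient can vanish in the ring.\<close>
  have keys: "Poly_Mapping.keys p \<subseteq> set_exponent ` F"
    by (auto simp: in_keys_iff lookup split: if_splits)
  have inj: "inj_on set_exponent F"
    by (rule inj_onI) (metis finS keys_set_exponent)
  have "mpoly_vars p \<subseteq> {..<n}"
  proof -
    have "Poly_Mapping.keys m \<subseteq> {..<n}" if m: "m \<in> Poly_Mapping.keys p" for m
    proof -
      obtain S where "S \<in> F" "m = set_exponent S" using m keys by blast
      then show ?thesis using keys_set_exponent[OF finS] F(1) by simp
    qed
    then show ?thesis unfolding mpoly_vars_def by blast
  qed
  moreover have "total_degree p \<le> d"
  proof -
    have "monom_degree m \<le> d" if m: "m \<in> Poly_Mapping.keys p" for m
    proof -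
      obtain S where "S \<in> F" "m = set_exponent S" using m keys by blast
      then show ?thesis using monom_degree_set_exponent[OF finS] F(2) by simp
    qed
    then show ?thesis unfolding total_degree_def by simp
  qed
  moreover have "bit_eval p x = of_int (f x)" for x
  proof -
    let ?v = "\<lambda>i. of_bool (x ! i) :: 'a"
    let ?g = "\<lambda>m. Poly_Mapping.lookup p m * prod_list (map (\<lambda>i. ?v i ^ Poly_Mapping.lookup m i)
      (sorted_list_of_set (Poly_Mapping.keys m)))"
    have "bit_eval p x = sum ?g (set_exponent ` F)"
      unfolding bit_eval_def mpoly_eval_def
      using fin keys by (intro sum.mono_neutral_left) (auto simp: in_keys_iff)
    also have "\<dots> = (\<Sum>S\<in>F. ?g (set_exponent S))"
      by (rule sum.reindex_cong[OF inj]) auto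
    also have "\<dots> = (\<Sum>S\<in>F. of_int (c S * monomial_fun S x))"
    proof (rule sum.cong[OF refl])
      fix S assume S: "S \<in> F"
      \<comment> \<open>All exponents on \<open>S\<close> are 1, so the ordered product is a product
        of zeros and ones, whose order is immaterial.\<close>
      have "map (\<lambda>i. ?v i ^ Poly_Mapping.lookup (set_exponent S) i) (sorted_list_of_set S) =
            map ?v (sorted_list_of_set S)"
        using finS[OF S] by (simp add: lookup_set_exponent)
      then show "?g (set_exponent S) = of_int (c S * monomial_fun S x)"
        using S finS[OF S]
        by (simp add: lookup keys_set_exponent prod_list_of_bool del: map_eq_conv)
    qed
    finally show ?thesis by (simp add: c)
  qed
  ultimately show ?thesis by blast
qed

section \<open>Interpolation in the Hamming weight\<close>

definition weight :: "nat \<Rightarrow> bool list \<Rightarrow> nat" where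
  "weight n x = card {i. i < n \<and> x ! i}"

lemma weight_le: "weight n x \<le> n"
  unfolding weight_def using card_mono[of "{..<n}" "{i. i < n \<and> x ! i}"] by auto

lemma weight_conv_count_list: "weight (length x) x = count_list x True"
proof -
  have "count_list x True = length (filter (\<lambda>b. b) x)"
    by (induction x) auto
  then show ?thesis by (simp add: weight_def length_filter_conv_card)
qed

text \<open>The binomial counts the \<open>j\<close>-subsets of the positions holding a one, so it
  is the \<open>j\<close>-th elementary symmetric polynomial.\<close>

lemma multilinear_weight_choose: "multilinear n j (\<lambda>x. int (weight n x choose j))"
proof -
  let ?F = "{S. S \<subseteq> {..<n} \<and> card S = j}"
  have fin: "finite ?F" by (rule finite_subset[of _ "Pow {..<n}"]) auto
  have "int (weight n x choose j) = (\<Sum>S\<in>?F. 1 * monomial_fun S x)" for x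
  proof -
    have "weight n x choose j = card {S. S \<subseteq> {i. i < n \<and> x ! i} \<and> card S = j}"
      unfolding weight_def by (subst n_subsets) auto
    also have "{S. S \<subseteq> {i. i < n \<and> x ! i} \<and> card S = j} = ?F \<inter> {S. \<forall>i\<in>S. x ! i}"
      by auto
    finally show ?thesis using fin by (simp add: sum_of_bool_eq)
  qed
  then show ?thesis
    using multilinear_sum[of ?F n j "\<lambda>S x. 1 * monomial_fun S x"] multilinear_monomial[of _ n j 1]
    by simp
qed

text \<open>Newton interpolation in the binomial basis: forward differences lower the degree by one,
  and no division occurs, so the coefficients stay integral.\<close>

lemma binomial_interpolation:
  fixes h :: "nat \<Rightarrow> int"
  shows "\<exists>c. \<forall>w\<in>{a..a + d}. h w = (\<Sum>j\<le>d. c j * int (w choose j))"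
proof (induction d arbitrary: h)
  case 0
  show ?case by (rule exI[of _ "\<lambda>_. h a"]) auto
next
  case (Suc d)
  obtain c where c: "\<And>w. w \<in> {a..a + d} \<Longrightarrow> h (Suc w) - h w = (\<Sum>j\<le>d. c j * int (w choose j))"
    using Suc[of "\<lambda>w. h (Suc w) - h w"] by auto
  \<comment> \<open>A discrete antiderivative of the interpolant of the differences, by Pascal's
    rule; it agrees with \<open>h\<close> on the window up to a constant.\<close>
  define \<phi> where "\<phi> w = (\<Sum>j\<le>d. c j * int (w choose Suc j))" for w
  have step: "\<phi> (Suc w) = \<phi> w + (\<Sum>j\<le>d. c j * int (w choose j))" for w
    by (simp add: \<phi>_def algebra_simps flip: sum.distrib)
  have "h (a + k) = (h a - \<phi> a) + \<phi> (a + k)" if "k \<le> Suc d" for k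
    using that
  proof (induction k)
    case (Suc k)
    then show ?case using c[of "a + k"] by (simp add: step)
  qed simp
  then have "h w = (h a - \<phi> a) + \<phi> w" if "w \<in> {a..a + Suc d}" for w
    using that le_Suc_ex[of a w] by fastforce
  \<comment> \<open>The constant goes with \<open>w choose 0\<close>; the other coefficients move up
    by one index.\<close>
  moreover have "(\<Sum>j\<le>Suc d. case_nat (h a - \<phi> a) c j * int (w choose j)) =
      (h a - \<phi> a) + \<phi> w" for w
    by (subst sum.atMost_Suc_shift) (simp add: \<phi>_def)
  ultimately have "\<forall>w\<in>{a..a + Suc d}. h w = (\<Sum>j\<le>Suc d. case_nat (h a - \<phi> a) c j * int (w choose j))"
    by presburger
  then show ?case by (rule exI[of _ "case_nat (h a - \<phi> a) c"])
qed

lemma multilinear_weight_interpolation: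
  fixes h :: "nat \<Rightarrow> int"
  shows "\<exists>f. multilinear n d f \<and> (\<forall>x. weight n x \<in> {a..a + d} \<longrightarrow> f x = h (weight n x))"
proof -
  obtain c where c: "\<And>w. w \<in> {a..a + d} \<Longrightarrow> h w = (\<Sum>j\<le>d. c j * int (w choose j))"
    using binomial_interpolation[of a d h] by auto
  have "multilinear n d (\<lambda>x. \<Sum>j\<le>d. c j * int (weight n x choose j))"
    by (intro multilinear_sum multilinear_scale)
       (auto intro: multilinear_mono[OF multilinear_weight_choose])
  then show ?thesis using c by auto
qed

lemma multilinear_weight_interpolation_real:
  fixes h :: "nat \<Rightarrow> int" and t g :: real
  assumes "0 \<le> g"
  shows "\<exists>f d. real d \<le> 2 * g \<and> multilinear n d f \<and>
           (\<forall>x. \<bar>real (weight n x) - t\<bar> \<le> g \<longrightarrow> f x = h (weight n x))"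
proof -
  \<comment> \<open>The naturals within \<open>g\<close> of \<open>t\<close> lie among
    \<open>d + 1\<close> consecutive ones starting at \<open>a\<close>. Truncating \<open>a\<close>
    at 0 loses nothing, as weights are nonnegative.\<close>
  define a d where "a = nat \<lceil>t - g\<rceil>" and "d = nat \<lfloor>2 * g\<rfloor>"
  have d: "int d = \<lfloor>2 * g\<rfloor>" using assms by (simp add: d_def)
  have a: "t - g \<le> real a" unfolding a_def by (rule real_nat_ceiling_ge)
  obtain f where f: "multilinear n d f"
    "\<And>x. weight n x \<in> {a..a + d} \<Longrightarrow> f x = h (weight n x)"
    using multilinear_weight_interpolation[of n d a h] by auto
  have "w \<in> {a..a + d}" if w: "\<bar>real w - t\<bar> \<le> g" for w
  proof -
    have "a \<le> w"
      unfolding a_def nat_le_iff ceiling_le_iff using w by (simp add: abs_le_iff)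
    moreover have "real w - real a \<le> 2 * g"
      using w a by (simp add: abs_le_iff)
    then have "int w - int a \<le> \<lfloor>2 * g\<rfloor>"
      unfolding le_floor_iff by simp
    then have "w \<le> a + d" using d by simp
    ultimately show ?thesis by simp
  qed
  moreover have "real d \<le> 2 * g" unfolding d_def using assms by (simp add: of_nat_nat)
  ultimately show ?thesis using f by blast
qed

section \<open>Concentration\<close>

lemma map_pmf_mem_bernoulli: "map_pmf (\<lambda>x. x \<in> B) D = bernoulli_pmf (measure_pmf.prob D B)"
proof (rule pmf_eqI)
  fix b :: bool
  have "(\<lambda>x. x \<in> B) -` {b} = (if b then B else - B)" by auto
  then show "pmf (map_pmf (\<lambda>x. x \<in> B) D) b = pmf (bernoulli_pmf (measure_pmf.prob D B)) b"
    using measure_pmf.prob_compl[of B D] by (simp add: pmf_map Compl_eq_Diff_UNIV)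
qed

lemma map_pmf_card_Pi_pmf:
  "map_pmf (\<lambda>f. card {j. j < T \<and> f j \<in> B}) (Pi_pmf {..<T} dflt (\<lambda>_. D)) =
     binomial_pmf T (measure_pmf.prob D B)"
proof -
  have "binomial_pmf T (measure_pmf.prob D B) = map_pmf (\<lambda>f. card {x\<in>{..<T}. f x})
      (Pi_pmf {..<T} (dflt \<in> B) (\<lambda>_. map_pmf (\<lambda>x. x \<in> B) D))"
    unfolding map_pmf_mem_bernoulli by (rule binomial_pmf_altdef') auto
  also have "Pi_pmf {..<T} (dflt \<in> B) (\<lambda>_. map_pmf (\<lambda>x. x \<in> B) D) =
      map_pmf (\<lambda>h. (\<lambda>x. x \<in> B) \<circ> h) (Pi_pmf {..<T} dflt (\<lambda>_. D))"
    by (rule Pi_pmf_map) auto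
  finally show ?thesis by (simp add: map_pmf_comp)
qed

text \<open>The number of hits of \<open>B\<close> among independent samples is binomial. The
  one-sided bound serves the selection of good samples, the two-sided one the recursion.\<close>

lemma Hoeffding_Pi_pmf:
  fixes T :: nat
  assumes "T > 0" "\<delta> \<ge> 0"
  shows "measure_pmf.prob (Pi_pmf {..<T} dflt (\<lambda>_. D))
           {f. real (card {j. j < T \<and> f j \<in> B}) \<ge> T * measure_pmf.prob D B + \<delta>}
           \<le> exp (- 2 * \<delta>\<^sup>2 / T)" (is ?ge)
    and "measure_pmf.prob (Pi_pmf {..<T} dflt (\<lambda>_. D))
           {f. \<bar>real (card {j. j < T \<and> f j \<in> B}) - T * measure_pmf.prob D B\<bar> \<ge> \<delta>}
           \<le> 2 * exp (- 2 * \<delta>\<^sup>2 / T)" (is ?abs)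
proof -
  interpret binomial_distribution T "measure_pmf.prob D B"
    by unfold_locales auto
  show ?ge
    using prob_ge[OF assms] unfolding map_pmf_card_Pi_pmf[of T B dflt D, symmetric]
    by (simp add: vimage_def)
  show ?abs
    using prob_abs_ge[OF assms] unfolding map_pmf_card_Pi_pmf[of T B dflt D, symmetric]
    by (simp add: vimage_def)
qed

text \<open>Failure in the second stage is charged 1 on the exceptional set \<open>B\<close> and at
  most \<open>b\<close> elsewhere.\<close>

lemma prob_bind_pmf_le:
  assumes "measure_pmf.prob M B \<le> a"
    and "\<And>y. y \<in> set_pmf M \<Longrightarrow> y \<notin> B \<Longrightarrow> measure_pmf.prob (N y) A \<le> b" and "0 \<le> b"
  shows "measure_pmf.prob (bind_pmf M N) A \<le> a + b"
proof -
  have "emeasure (bind_pmf M N) A = (\<integral>\<^sup>+y. emeasure (N y) A \<partial>measure_pmf M)"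
    by (rule emeasure_bind_pmf)
  also have "\<dots> \<le> (\<integral>\<^sup>+y. indicator B y + ennreal b \<partial>measure_pmf M)"
  proof (rule nn_integral_mono_AE, rule AE_pmfI)
    fix y assume y: "y \<in> set_pmf M"
    show "emeasure (N y) A \<le> indicator B y + ennreal b"
    proof (cases "y \<in> B")
      case True
      have "emeasure (N y) A \<le> 1" by (rule measure_pmf.emeasure_le_1)
      then show ?thesis using True by (simp add: add_increasing2)
    next
      case False
      then show ?thesis
        using assms(2)[OF y] assms(3) by (simp add: measure_pmf.emeasure_eq_measure ennreal_leI)
    qed
  qed
  also have "\<dots> = emeasure M B + ennreal b"
    by (subst nn_integral_add) auto
  also have "\<dots> \<le> ennreal (a + b)"
    using assms order_trans[OF measure_nonneg assms(1)]
    by (simp add: measure_pmf.emeasure_eq_measure ennreal_plus[symmetric] ennreal_leI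
        del: ennreal_plus)
  finally show ?thesis
    using assms(3) order_trans[OF measure_nonneg assms(1)]
    by (simp add: measure_pmf.emeasure_eq_measure del: ennreal_plus)
qed

section \<open>Thresholds by recursive sampling\<close>

text \<open>The threshold is an arbitrary real, since the recursion shifts it by \<delta> and may
  push it out of the range from 0 to \<open>n\<close>.\<close>

definition threshold_pmf :: "nat \<Rightarrow> real \<Rightarrow> real \<Rightarrow> nat \<Rightarrow> (bool list \<Rightarrow> int) pmf \<Rightarrow> bool" where
  "threshold_pmf n t \<epsilon> d D \<longleftrightarrow> (\<forall>f\<in>set_pmf D. multilinear n d f) \<and>
     (\<forall>x. measure_pmf.prob D {f. f x \<noteq> of_bool (t \<le> real (weight n x))} \<le> \<epsilon>)"

lemma threshold_pmf_exact:
  assumes "0 \<le> \<epsilon>"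
  shows "\<exists>D. threshold_pmf n t \<epsilon> n D"
proof -
  obtain f where "multilinear n n f"
    "\<And>x. weight n x \<in> {0..0 + n} \<Longrightarrow> f x = of_bool (t \<le> real (weight n x))"
    using multilinear_weight_interpolation[of n n 0 "\<lambda>w. of_bool (t \<le> real w)"] by auto
  then have "threshold_pmf n t \<epsilon> n (return_pmf f)"
    using assms weight_le by (simp add: threshold_pmf_def)
  then show ?thesis by blast
qed

text \<open>Here \<open>W\<close> is the true weight and \<open>w\<close> the sample weight. Outside
  the window around \<open>r * t\<close>, \<open>u = v\<close> is the correct answer; inside it
  \<open>u = 1\<close> and \<open>v = 0\<close>, so the expression is \<open>A\<close>, and
  \<open>W\<close> is close enough to \<open>t\<close> for \<open>A\<close> to be right.\<close>

lemma of_bool_threshold_refine: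
  fixes w W t r \<delta> :: real and u v A :: int
  assumes "r > 0" "\<bar>w - r * W\<bar> < \<delta>"
    and "u = of_bool (r * t - \<delta> \<le> w)" "v = of_bool (r * t + \<delta> \<le> w)"
    and "\<bar>W - t\<bar> \<le> 2 * \<delta> / r \<Longrightarrow> A = of_bool (t \<le> W)"
  shows "v + (u - v) * A = of_bool (t \<le> W)"
proof -
  have \<delta>: "\<delta> > 0" using assms(2) by linarith
  consider "r * t + \<delta> \<le> w" | "w < r * t - \<delta>" | "r * t - \<delta> \<le> w" "w < r * t + \<delta>"
    by linarith
  then show ?thesis
  proof cases
    case 1
    then have "r * t \<le> r * W" using assms(2) by linarith
    then show ?thesis using 1 \<delta> assms(1,3,4) by simp
  next
    case 2
    then have "r * W < r * t" using assms(2) by linarith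
    then show ?thesis using 2 \<delta> assms(1,3,4) by simp
  next
    case 3
    then have "\<bar>r * W - r * t\<bar> \<le> 2 * \<delta>" using assms(2) by linarith
    then have "r * \<bar>W - t\<bar> \<le> 2 * \<delta>"
      using assms(1) by (simp add: abs_mult flip: right_diff_distrib)
    then have "\<bar>W - t\<bar> \<le> 2 * \<delta> / r" using assms(1) by (simp add: field_simps)
    then show ?thesis using 3 assms(3-5) by simp
  qed
qed

lemma prob_pair_pmf_union_le:
  "measure_pmf.prob (pair_pmf M N) {z. fst z \<in> A \<or> snd z \<in> B} \<le>
     measure_pmf.prob M A + measure_pmf.prob N B"
proof -
  have "measure_pmf.prob (pair_pmf M N) (fst -` A \<union> snd -` B) \<le>
      measure_pmf.prob (pair_pmf M N) (fst -` A) + measure_pmf.prob (pair_pmf M N) (snd -` B)"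
    by (rule measure_Un_le) auto
  also have "\<dots> = measure_pmf.prob (map_pmf fst (pair_pmf M N)) A +
      measure_pmf.prob (map_pmf snd (pair_pmf M N)) B"
    by (simp only: measure_map_pmf)
  finally show ?thesis
    by (simp add: map_fst_pair_pmf map_snd_pair_pmf vimage_def Un_def)
qed

text \<open>The error budget is \<open>\<epsilon> / 2\<close> for a misleading sample and
  \<open>\<epsilon> / 4\<close> for each of the two smaller thresholds.\<close>

lemma threshold_pmf_step:
  fixes n m :: nat and t \<epsilon> \<delta> :: real
  assumes "0 < m" "0 < n" "0 \<le> \<delta>" "2 * exp (- 2 * \<delta>\<^sup>2 / m) \<le> \<epsilon> / 2"
    and Dl: "threshold_pmf m (real m / real n * t - \<delta>) (\<epsilon> / 4) d Dl"
    and Dh: "threshold_pmf m (real m / real n * t + \<delta>) (\<epsilon> / 4) d Dh"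
  shows "\<exists>D e. real e \<le> 4 * \<delta> * real n / real m \<and> threshold_pmf n t \<epsilon> (d + e) D"
proof -
  define r where "r = real m / real n"
  have r: "r > 0" using assms by (simp add: r_def)
  obtain A e where e: "real e \<le> 2 * (2 * \<delta> / r)" and A: "multilinear n e A"
    "\<And>x. \<bar>real (weight n x) - t\<bar> \<le> 2 * \<delta> / r \<Longrightarrow> A x = of_bool (t \<le> real (weight n x))"
    using multilinear_weight_interpolation_real[of "2 * \<delta> / r" n t "\<lambda>w. of_bool (t \<le> real w)"]
      r assms(3) by auto
  \<comment> \<open>\<open>\<sigma>\<close> picks \<open>m\<close> independent uniform coordinates,
    and \<open>sub \<sigma> x\<close> is the sampled string.\<close>
  define M where "M = Pi_pmf {..<m} 0 (\<lambda>_. pmf_of_set {..<n})"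
  define sub where "sub \<sigma> x = map (\<lambda>j. x ! \<sigma> j) [0..<m]" for \<sigma> :: "nat \<Rightarrow> nat" and x :: "bool list"
  define comb where "comb \<sigma> z x = snd z (sub \<sigma> x) + (fst z (sub \<sigma> x) - snd z (sub \<sigma> x)) * A x"
    for \<sigma> and z :: "(bool list \<Rightarrow> int) \<times> (bool list \<Rightarrow> int)" and x
  define D where "D = bind_pmf M (\<lambda>\<sigma>. map_pmf (comb \<sigma>) (pair_pmf Dl Dh))"
  have "multilinear n (d + e) f" if f: "f \<in> set_pmf D" for f
  proof -
    obtain \<sigma> u v where \<sigma>: "\<sigma> \<in> set_pmf M" and u: "u \<in> set_pmf Dl" and v: "v \<in> set_pmf Dh"
      and f_eq: "f = comb \<sigma> (u, v)"
      using f by (auto simp: D_def)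
    have \<sigma>': "\<sigma> j < n" if "j < m" for j
      using \<sigma> that assms(2) unfolding M_def
      by (auto simp: set_Pi_pmf PiE_dflt_def set_pmf_of_set lessThan_empty_iff)
    have uv: "multilinear n d (\<lambda>x. u (sub \<sigma> x))" "multilinear n d (\<lambda>x. v (sub \<sigma> x))"
      unfolding sub_def
      using Dl Dh u v by (auto simp: threshold_pmf_def intro!: multilinear_subst[OF _ \<sigma>'])
    have "multilinear n (d + e)
        (\<lambda>x. v (sub \<sigma> x) + (u (sub \<sigma> x) - v (sub \<sigma> x)) * A x)"
      by (intro multilinear_add multilinear_mult multilinear_diff uv A(1)
          multilinear_mono[OF uv(2)]) simp
    then show ?thesis by (simp add: f_eq comb_def[abs_def])
  qed
  moreover have "measure_pmf.prob D {f. f x \<noteq> of_bool (t \<le> real (weight n x))} \<le> \<epsilon>" for x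
  proof -
    \<comment> \<open>A sampled coordinate hits \<open>B\<close> with probability
      \<open>weight n x / n\<close>, and \<open>Y\<close> collects the samples whose weight is off
      by at least \<delta>.\<close>
    define B where "B = {i. x ! i}"
    define Y where "Y = {\<sigma>. \<delta> \<le> \<bar>real (card {j. j < m \<and> \<sigma> j \<in> B}) -
      real m * measure_pmf.prob (pmf_of_set {..<n}) B\<bar>}"
    have prob_B: "measure_pmf.prob (pmf_of_set {..<n}) B = real (weight n x) / real n"
    proof -
      have "{..<n} \<inter> B = {i. i < n \<and> x ! i}" by (auto simp: B_def)
      then show ?thesis
        using assms(2) by (simp add: measure_pmf_of_set lessThan_empty_iff weight_def)
    qed
    have weight_sub: "weight m (sub \<sigma> x) = card {j. j < m \<and> \<sigma> j \<in> B}" for \<sigma>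
      unfolding weight_def B_def sub_def by (rule arg_cong[of _ _ card]) auto
    have "measure_pmf.prob D {f. f x \<noteq> of_bool (t \<le> real (weight n x))} \<le> \<epsilon> / 2 + (\<epsilon> / 4 + \<epsilon> / 4)"
      unfolding D_def
    proof (rule prob_bind_pmf_le)
      show "measure_pmf.prob M Y \<le> \<epsilon> / 2"
        unfolding M_def Y_def by (rule order_trans[OF Hoeffding_Pi_pmf(2)[OF assms(1,3)] assms(4)])
      have "0 \<le> measure_pmf.prob M Y" by simp
      then show "0 \<le> \<epsilon> / 4 + \<epsilon> / 4"
        using \<open>measure_pmf.prob M Y \<le> \<epsilon> / 2\<close> by linarith
    next
      fix \<sigma> assume "\<sigma> \<notin> Y"
      then have near: "\<bar>real (weight m (sub \<sigma> x)) - r * real (weight n x)\<bar> < \<delta>"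
        by (simp add: Y_def prob_B weight_sub r_def)
      let ?U = "{f. f (sub \<sigma> x) \<noteq> of_bool (r * t - \<delta> \<le> real (weight m (sub \<sigma> x)))}"
      let ?V = "{f. f (sub \<sigma> x) \<noteq> of_bool (r * t + \<delta> \<le> real (weight m (sub \<sigma> x)))}"
      have "measure_pmf.prob (map_pmf (comb \<sigma>) (pair_pmf Dl Dh))
          {f. f x \<noteq> of_bool (t \<le> real (weight n x))} =
        measure_pmf.prob (pair_pmf Dl Dh) {z. comb \<sigma> z x \<noteq> of_bool (t \<le> real (weight n x))}"
        by (simp add: vimage_def)
      also have "\<dots> \<le> measure_pmf.prob (pair_pmf Dl Dh) {z. fst z \<in> ?U \<or> snd z \<in> ?V}"
      proof (rule measure_pmf.finite_measure_mono)
        show "{z. comb \<sigma> z x \<noteq> of_bool (t \<le> real (weight n x))} \<subseteq> {z. fst z \<in> ?U \<or> snd z \<in> ?V}"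
        proof (rule subsetI, rule ccontr)
          fix z
          assume "z \<in> {z. comb \<sigma> z x \<noteq> of_bool (t \<le> real (weight n x))}"
            and "z \<notin> {z. fst z \<in> ?U \<or> snd z \<in> ?V}"
          then show False
            using of_bool_threshold_refine[OF r near, of "fst z (sub \<sigma> x)" t "snd z (sub \<sigma> x)" "A x"]
              A(2)[of x] by (simp add: comb_def)
        qed
      qed simp
      also have "\<dots> \<le> measure_pmf.prob Dl ?U + measure_pmf.prob Dh ?V"
        by (rule prob_pair_pmf_union_le)
      also have "\<dots> \<le> \<epsilon> / 4 + \<epsilon> / 4"
        using Dl Dh unfolding threshold_pmf_def r_def by (intro add_mono) blast+
      finally show "measure_pmf.prob (map_pmf (comb \<sigma>) (pair_pmf Dl Dh))
          {f. f x \<noteq> of_bool (t \<le> real (weight n x))} \<le> \<epsilon> / 4 + \<epsilon> / 4" .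
    qed
    then show ?thesis by simp
  qed
  ultimately have "threshold_pmf n t \<epsilon> (d + e) D"
    by (simp add: threshold_pmf_def)
  moreover have "real e \<le> 4 * \<delta> * real n / real m"
    using e assms(1,2) by (simp add: r_def field_simps)
  ultimately show ?thesis by blast
qed

lemma threshold_pmf_mono:
  "threshold_pmf n t \<epsilon> d D \<Longrightarrow> d \<le> e \<Longrightarrow> threshold_pmf n t \<epsilon> e D"
  using multilinear_mono by (fastforce simp: threshold_pmf_def)

section \<open>Degree bookkeeping for the recursion\<close>

lemma ln_4_le_ln_div:
  fixes \<epsilon> :: real
  assumes "0 < \<epsilon>" "\<epsilon> \<le> 1 / 2"
  shows "3 / 2 * ln 4 \<le> ln (4 / \<epsilon>)"
proof -
  have "3 / 2 * ln (4::real) = ln 8"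
    using ln_realpow[of "2::real" 2] ln_realpow[of "2::real" 3] by simp
  also have "\<dots> \<le> ln (4 / \<epsilon>)"
    using assms by (subst ln_le_cancel_iff) (auto simp: field_simps)
  finally show ?thesis .
qed

text \<open>Halving \<open>n\<close> while \<open>L\<close> grows to at most
  \<open>5 / 3 * L\<close> scales the radicand by at most 5/6, which is below the square of 0.915.
  The interpolation term is at most \<open>sqrt (24 * n * L)\<close>, hence below 5 times the root.
  The constant 60 works because 60 * 0.915 + 5 = 59.9.\<close>

lemma sqrt_recursion:
  fixes n m :: nat and L \<delta> :: real
  assumes "2 * m \<le> n" "n \<le> 3 * m" "0 < m" "3 / 2 * ln 4 \<le> L" "\<delta> = sqrt (real m * L / 2)"
  shows "60 * sqrt (real m * (L + ln 4)) + 4 * \<delta> * real n / real m \<le> 60 * sqrt (real n * L)"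
proof -
  have L: "L \<ge> 0" using assms(4) ln_ge_zero[of "4::real"] by linarith
  have "real m * (L + ln 4) \<le> (real n / 2) * (5 / 3 * L)"
    using assms L by (intro mult_mono) auto
  also have "\<dots> \<le> 0.915\<^sup>2 * (real n * L)"
    using L by (simp add: power2_eq_square mult_right_mono)
  finally have "sqrt (real m * (L + ln 4)) \<le> sqrt (0.915\<^sup>2 * (real n * L))"
    by simp
  also have "\<dots> = 0.915 * sqrt (real n * L)" by (simp add: real_sqrt_mult)
  finally have 1: "sqrt (real m * (L + ln 4)) \<le> 0.915 * sqrt (real n * L)" .
  have "4 * \<delta> * real n / real m \<le> sqrt (25 * (real n * L))"
  proof (rule real_le_rsqrt)
    have "\<delta>\<^sup>2 = real m * L / 2" using assms(5) L by simp
    then have "(4 * \<delta> * real n / real m)\<^sup>2 = 16 * (real m * L / 2) * (real n)\<^sup>2 / (real m)\<^sup>2"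
      by (simp only: power_divide power_mult_distrib) simp
    also have "\<dots> = 8 * L * real n * (real n / real m)"
      using assms(3) by (simp add: power2_eq_square)
    also have "\<dots> \<le> 8 * L * real n * 3"
      using assms(2,3) L by (intro mult_left_mono) (auto simp: field_simps)
    also have "\<dots> \<le> 25 * (real n * L)" using L by simp
    finally show "(4 * \<delta> * real n / real m)\<^sup>2 \<le> 25 * (real n * L)" .
  qed
  also have "\<dots> = 5 * sqrt (real n * L)" by (simp add: real_sqrt_mult)
  finally have "60 * sqrt (real m * (L + ln 4)) + 4 * \<delta> * real n / real m \<le>
      60 * (0.915 * sqrt (real n * L)) + 5 * sqrt (real n * L)"
    using 1 by linarith
  also have "\<dots> \<le> 60 * sqrt (real n * L)" using L by simp
  finally show ?thesis .
qed

text \<open>The bound \<open>\<epsilon> \<le> 1 / 2\<close> makes the recursive degrees shrink: it gives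
  \<open>ln (16 / \<epsilon>) \<le> 5 / 3 * ln (4 / \<epsilon>)\<close>, which halving \<open>n\<close> outweighs.\<close>

lemma threshold_pmf_exists:
  fixes t \<epsilon> :: real
  assumes "0 < \<epsilon>" "\<epsilon> \<le> 1 / 2"
  shows "\<exists>D d. real d \<le> 60 * sqrt (real n * ln (4 / \<epsilon>)) \<and> threshold_pmf n t \<epsilon> d D"
  using assms
proof (induction n arbitrary: t \<epsilon> rule: less_induct)
  case (less n)
  define L where "L = ln (4 / \<epsilon>)"
  have L: "3 / 2 * ln 4 \<le> L" using ln_4_le_ln_div less.prems unfolding L_def by blast
  have ln4: "1 \<le> ln (4::real)"
    using exp_le by (subst ln_ge_iff) auto
  show ?case
  \<comment> \<open>For \<open>n \<le> 1\<close> halving would leave no bits to sample; the exact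
    polynomial of degree \<open>n\<close> is cheap enough since \<open>L\<close> is at least
    1.\<close>
  proof (cases "n \<le> 1")
    case True
    have "real n \<le> sqrt (real n * L)"
      using True L ln4 by (cases "n = 0") (auto simp: le_Suc_eq)
    then have "real n \<le> 60 * sqrt (real n * L)" by linarith
    then show ?thesis
      using threshold_pmf_exact[of \<epsilon> n t] less.prems unfolding L_def by auto
  next
    case False
    define m where "m = n div 2"
    \<comment> \<open>The factor 3 is attained at \<open>n = 3\<close>.\<close>
    have m: "2 * m \<le> n" "n \<le> 3 * m" "0 < m" "m < n" using False by (auto simp: m_def)
    \<comment> \<open>Chosen to make the Hoeffding bound \<open>2 * exp (- L)\<close>, which equals
      \<open>\<epsilon> / 2\<close>.\<close>
    define \<delta> where "\<delta> = sqrt (real m * L / 2)"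
    have \<delta>: "\<delta> \<ge> 0" using L ln4 by (simp add: \<delta>_def)
    have "2 * exp (- 2 * \<delta>\<^sup>2 / real m) = 2 * exp (- L)"
      using m L ln4 by (simp add: \<delta>_def)
    also have "\<dots> = \<epsilon> / 2"
      using less.prems by (simp add: L_def exp_minus)
    finally have exp_le: "2 * exp (- 2 * \<delta>\<^sup>2 / real m) \<le> \<epsilon> / 2" by simp
    have L': "ln (4 / (\<epsilon> / 4)) = L + ln 4"
      using less.prems ln_mult_pos[of "4 / \<epsilon>" 4] by (simp add: L_def)
    have ih: "\<exists>D d. real d \<le> 60 * sqrt (real m * (L + ln 4)) \<and> threshold_pmf m t' (\<epsilon> / 4) d D" for t'
      using less.IH[OF m(4), of "\<epsilon> / 4" t'] less.prems unfolding L' by simp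
    obtain Dl dl where Dl: "real dl \<le> 60 * sqrt (real m * (L + ln 4))"
      "threshold_pmf m (real m / real n * t - \<delta>) (\<epsilon> / 4) dl Dl" using ih by blast
    obtain Dh dh where Dh: "real dh \<le> 60 * sqrt (real m * (L + ln 4))"
      "threshold_pmf m (real m / real n * t + \<delta>) (\<epsilon> / 4) dh Dh" using ih by blast
    \<comment> \<open>The two recursive distributions are brought to the common degree
      \<open>max dl dh\<close>.\<close>
    obtain D e where e: "real e \<le> 4 * \<delta> * real n / real m"
      and D: "threshold_pmf n t \<epsilon> (max dl dh + e) D"
      using threshold_pmf_step[OF m(3) _ \<delta> exp_le threshold_pmf_mono[OF Dl(2)]
          threshold_pmf_mono[OF Dh(2)], of "max dl dh"] m by auto
    have "real (max dl dh + e) \<le> 60 * sqrt (real m * (L + ln 4)) + 4 * \<delta> * real n / real m"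
      using e Dl(1) Dh(1) by simp
    also have "\<dots> \<le> 60 * sqrt (real n * L)"
      by (rule sqrt_recursion[OF m(1-3) L \<delta>_def])
    finally show ?thesis using D unfolding L_def by blast
  qed
qed

section \<open>Sampling with few random bits\<close>

text \<open>Newman's argument: for one input, the share of bad samples exceeds its mean by \<delta>
  only with exponentially small probability. A union bound over \<open>X\<close> leaves some list of
  \<open>T\<close> samples that is good for all inputs at once.\<close>

lemma exists_good_samples:
  fixes T :: nat and D :: "'b pmf" and bad :: "'x \<Rightarrow> 'b set"
  assumes "finite X" "T > 0" "\<delta> \<ge> 0" "\<And>x. x \<in> X \<Longrightarrow> measure_pmf.prob D (bad x) \<le> q"
    and small: "real (card X) * exp (- 2 * \<delta>\<^sup>2 * real T) < 1"
  shows "\<exists>F. (\<forall>j<T. F j \<in> set_pmf D) \<and>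
           (\<forall>x\<in>X. real (card {j. j < T \<and> F j \<in> bad x}) \<le> real T * (q + \<delta>))"
proof -
  define M where "M = Pi_pmf {..<T} undefined (\<lambda>_. D)"
  define E where "E x = {f. real (card {j. j < T \<and> f j \<in> bad x}) \<ge>
    real T * measure_pmf.prob D (bad x) + real T * \<delta>}" for x
  have E: "measure_pmf.prob M (E x) \<le> exp (- 2 * \<delta>\<^sup>2 * real T)" for x
    using Hoeffding_Pi_pmf(1)[OF assms(2), of "real T * \<delta>" undefined D "bad x"] assms(2,3)
    unfolding M_def E_def by (simp add: power_mult_distrib power2_eq_square mult_ac)
  have "measure_pmf.prob M (\<Union>x\<in>X. E x) \<le> (\<Sum>x\<in>X. measure_pmf.prob M (E x))"
    using assms(1) by (intro measure_pmf.finite_measure_subadditive_finite) auto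
  also have "\<dots> \<le> real (card X) * exp (- 2 * \<delta>\<^sup>2 * real T)"
    using sum_mono[of X "\<lambda>x. measure_pmf.prob M (E x)", OF E] by simp
  also have "\<dots> < 1" by (rule small)
  finally have "\<not> (AE f in measure_pmf M. f \<in> (\<Union>x\<in>X. E x))"
    by (subst measure_pmf.prob_eq_1[symmetric]) auto
  then obtain F where F: "F \<in> set_pmf M" "F \<notin> (\<Union>x\<in>X. E x)"
    by (auto simp: AE_measure_pmf_iff)
  have "F j \<in> set_pmf D" if "j < T" for j
    using F(1) that unfolding M_def by (auto simp: set_Pi_pmf PiE_dflt_def)
  moreover have "real (card {j. j < T \<and> F j \<in> bad x}) \<le> real T * (q + \<delta>)" if "x \<in> X" for x
  proof -
    have "real (card {j. j < T \<and> F j \<in> bad x}) \<le>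
        real T * measure_pmf.prob D (bad x) + real T * \<delta>"
      using F(2) that by (force simp: E_def)
    also have "\<dots> \<le> real T * q + real T * \<delta>"
      using assms(4)[OF that] by (simp add: mult_left_mono)
    finally show ?thesis by (simp add: distrib_left)
  qed
  ultimately show ?thesis by blast
qed

section \<open>Random bits as an index into the samples\<close>

lemma finite_bitstrings: "finite (bitstrings n)"
  and card_bitstrings: "card (bitstrings n) = 2 ^ n"
  using finite_lists_length_eq[of "UNIV :: bool set" n] card_lists_length_eq[of "UNIV :: bool set" n]
  by (simp_all add: bitstrings_def)

lemma bitstrings_nonempty: "bitstrings n \<noteq> {}"
  using card_bitstrings[of n] by auto

lemma TH_conv_weight:
  assumes "x \<in> bitstrings n" "0 < n"
  shows "TH \<theta> x \<longleftrightarrow> \<theta> * real n \<le> real (weight n x)"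
  using assms weight_conv_count_list[of x] by (auto simp: TH_def bitstrings_def field_simps)

lemma probabilistic_polynomial_from_samples:
  fixes F :: "nat \<Rightarrow> bool list \<Rightarrow> int"
  assumes F: "\<And>j. j < 2 ^ r \<Longrightarrow> multilinear n d (F j)"
    and bad: "\<And>x. x \<in> bitstrings n \<Longrightarrow>
      real (card {j. j < 2 ^ r \<and> F j x \<noteq> of_bool (f x)}) \<le> 2 ^ r * \<epsilon>"
  shows "\<exists>D :: 'a::ring_1 mpoly pmf. probabilistic_polynomial n f \<epsilon> d D \<and> sampled_by_bits r D"
proof -
  have "\<exists>p :: 'a mpoly. mpoly_vars p \<subseteq> {..<n} \<and> total_degree p \<le> d \<and>
      (\<forall>x. bit_eval p x = of_int (F j x))" if "j < 2 ^ r" for j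
    by (rule multilinear_mpoly[OF F[OF that]])
  then obtain P :: "nat \<Rightarrow> 'a mpoly" where P: "\<And>j. j < 2 ^ r \<Longrightarrow> mpoly_vars (P j) \<subseteq> {..<n}"
    "\<And>j. j < 2 ^ r \<Longrightarrow> total_degree (P j) \<le> d"
    "\<And>j x. j < 2 ^ r \<Longrightarrow> bit_eval (P j) x = of_int (F j x)"
    by metis
  \<comment> \<open>A uniform string of \<open>r\<close> bits is a uniform index below
    \<open>2 ^ r\<close>.\<close>
  obtain b where b: "bij_betw b (bitstrings r) {..<2 ^ r :: nat}"
    using finite_same_card_bij[OF finite_bitstrings[of r] finite_lessThan[of "2 ^ r :: nat"]]
    by (auto simp: card_bitstrings)
  then have b_less: "b y < 2 ^ r" if "y \<in> bitstrings r" for y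
    using that bij_betwE by fastforce
  define D where "D = map_pmf (\<lambda>y. P (b y)) (pmf_of_set (bitstrings r))"
  have set_D: "set_pmf D = (\<lambda>y. P (b y)) ` bitstrings r"
    by (simp add: D_def finite_bitstrings bitstrings_nonempty)
  have "1 - \<epsilon> \<le> measure_pmf.prob D {p. bit_eval p x = of_bool (f x)}" if x: "x \<in> bitstrings n" for x
  proof -
    let ?B = "{y \<in> bitstrings r. F (b y) x \<noteq> of_bool (f x)}"
    have "b ` ?B \<subseteq> {j. j < 2 ^ r \<and> F j x \<noteq> of_bool (f x)}" "inj_on b ?B"
      using b_less bij_betw_imp_inj_on[OF b] by (auto intro: inj_on_subset)
    then have "card ?B \<le> card {j. j < 2 ^ r \<and> F j x \<noteq> of_bool (f x)}"
      by (intro card_inj_on_le) auto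
    then have card_B: "real (card ?B) \<le> 2 ^ r * \<epsilon>"
      using bad[OF x] by linarith
    \<comment> \<open>Only an inclusion: in positive characteristic a wrong integer value may still
      have the right image in the ring.\<close>
    have "bitstrings r - ?B \<subseteq> bitstrings r \<inter> {y. bit_eval (P (b y)) x = of_bool (f x)}"
      using P(3) b_less by auto
    then have "card (bitstrings r - ?B) \<le>
        card (bitstrings r \<inter> {y. bit_eval (P (b y)) x = of_bool (f x)})"
      by (intro card_mono) (auto simp: finite_bitstrings)
    moreover have "real (card (bitstrings r - ?B)) = 2 ^ r - real (card ?B)"
      using card_mono[of "bitstrings r" ?B]
      by (subst card_Diff_subset) (auto simp: finite_bitstrings card_bitstrings of_nat_diff)
    ultimately have "2 ^ r * (1 - \<epsilon>) \<le>
        real (card (bitstrings r \<inter> {y. bit_eval (P (b y)) x = of_bool (f x)}))"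
      using card_B by (simp add: right_diff_distrib)
    then show ?thesis
      by (simp add: D_def vimage_def measure_pmf_of_set finite_bitstrings bitstrings_nonempty
          card_bitstrings field_simps)
  qed
  moreover have "mpoly_vars p \<subseteq> {..<n}" "total_degree p \<le> d" if "p \<in> set_pmf D" for p
    using that P(1,2) b_less unfolding set_D by blast+
  ultimately have "probabilistic_polynomial n f \<epsilon> d D"
    by (simp add: probabilistic_polynomial_def)
  moreover have "sampled_by_bits r D"
    unfolding sampled_by_bits_def D_def by blast
  ultimately show ?thesis by blast
qed

section \<open>Choice of parameters\<close>

lemma exists_sample_bits:
  assumes "n \<ge> 2" "s \<ge> 2"
  shows "\<exists>r. 2 * real n * s\<^sup>2 \<le> 2 ^ r \<and>
    real r \<le> 4 / (ln 2)\<^sup>2 * (ln (real n) * ln (real n * s))"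
proof -
  define r where "r = nat \<lceil>log 2 (2 * real n * s\<^sup>2)\<rceil>"
  have pos: "2 * real n * s\<^sup>2 > 0" using assms by simp
  have "2 * real n * s\<^sup>2 = 2 powr (log 2 (2 * real n * s\<^sup>2))" using pos by simp
  also have "\<dots> \<le> 2 powr real r"
    unfolding r_def by (intro powr_mono real_nat_ceiling_ge) auto
  finally have 1: "2 * real n * s\<^sup>2 \<le> 2 ^ r" by (simp add: powr_realpow)
  have ns: "4 \<le> real n * s" using assms mult_mono[of 2 "real n" 2 s] by simp
  have "log 2 (2 * real n * s\<^sup>2) \<le> log 2 (2 * (real n * s)\<^sup>2)"
    using assms pos by (subst log_le_cancel_iff) (auto simp: power_mult_distrib power2_eq_square)
  also have "\<dots> = 1 + 2 * log 2 (real n * s)"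
    using ns assms by (simp add: log_mult log_nat_power)
  finally have "log 2 (2 * real n * s\<^sup>2) \<le> 1 + 2 * log 2 (real n * s)" .
  moreover have "2 = log 2 (2\<^sup>2::real)" by (subst log_nat_power) auto
  then have log2: "2 \<le> log 2 (real n * s)" using ns by (simp add: le_log_iff)
  moreover have "real r \<le> max 0 (log 2 (2 * real n * s\<^sup>2) + 1)"
    unfolding r_def by linarith
  ultimately have "real r \<le> 4 * log 2 (real n * s)" by simp
  \<comment> \<open>As \<open>n \<ge> 2\<close>, the extra factor is at least 1; it brings the bound
    into the form of the theorem.\<close>
  also have "\<dots> \<le> 4 * log 2 (real n * s) * log 2 (real n)"
    using assms log2 by (simp add: mult_le_cancel_left1 le_log_iff)
  also have "\<dots> = 4 / (ln 2)\<^sup>2 * (ln (real n) * ln (real n * s))"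
    by (simp add: log_def power2_eq_square)
  finally show ?thesis using 1 by blast
qed

text \<open>Since \<open>8 \<le> s ^ 3\<close>. This absorbs the constant in
  \<open>ln (4 / \<epsilon>)\<close> at \<open>\<epsilon> = 1 / (2 * s)\<close>.\<close>

lemma ln_8_mult_le:
  fixes s :: real
  assumes "s \<ge> 2"
  shows "ln (8 * s) \<le> 4 * ln s"
proof -
  have "8 * s \<le> s ^ 3 * s"
    using power_mono[of 2 s 3] assms by (intro mult_right_mono) auto
  also have "\<dots> = s ^ 4" by (simp add: eval_nat_numeral)
  finally have "ln (8 * s) \<le> ln (s ^ 4)" using assms by (subst ln_le_cancel_iff) auto
  then show ?thesis using assms by (simp add: ln_realpow)
qed

lemma exists_probabilistic_polynomial:
  fixes \<theta> s :: real and n :: nat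
  assumes n: "n \<ge> 2" and s: "s \<ge> 2"
  shows "\<exists>(D :: 'a::ring_1 mpoly pmf) d r.
    probabilistic_polynomial n (TH \<theta>) (1 / s) d D \<and> real d \<le> 120 * sqrt (real n * ln s) \<and>
    sampled_by_bits r D \<and> real r \<le> 4 / (ln 2)\<^sup>2 * (ln (real n) * ln (real n * s))"
proof -
  \<comment> \<open>Half of the error \<open>1 / s\<close> goes to the recursion, the other half to
    replacing its distribution by a sample list.\<close>
  obtain D d where d: "real d \<le> 60 * sqrt (real n * ln (4 / (1 / (2 * s))))"
    and D: "threshold_pmf n (\<theta> * real n) (1 / (2 * s)) d D"
    using threshold_pmf_exists[of "1 / (2 * s)" n "\<theta> * real n"] s by (auto simp: field_simps)
  have "sqrt (real n * ln (8 * s)) \<le> sqrt (4 * (real n * ln s))"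
    using ln_8_mult_le[OF s] mult_left_mono[of "ln (8 * s)" "4 * ln s" "real n"] by simp
  also have "\<dots> = 2 * sqrt (real n * ln s)" by (simp add: real_sqrt_mult)
  finally have "real d \<le> 120 * sqrt (real n * ln s)" using d by simp
  moreover obtain r where r: "2 * real n * s\<^sup>2 \<le> 2 ^ r"
    "real r \<le> 4 / (ln 2)\<^sup>2 * (ln (real n) * ln (real n * s))"
    using exists_sample_bits[OF n s] by blast
  moreover define bad where
    "bad x = {f :: bool list \<Rightarrow> int. f x \<noteq> of_bool (\<theta> * real n \<le> real (weight n x))}" for x
  have small: "real (card (bitstrings n)) * exp (- 2 * (1 / (2 * s))\<^sup>2 * real (2 ^ r)) < 1"
  proof -
    \<comment> \<open>The number \<open>2 ^ r\<close> of samples makes the exponent at least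
      \<open>n\<close>, so the union bound over \<open>2 ^ n\<close> inputs is below 1 because 2 is
      less than e.\<close>
    have "real n \<le> 2 * (1 / (2 * s))\<^sup>2 * real (2 ^ r)"
      using r(1) s by (simp add: field_simps power2_eq_square)
    then have "2 ^ n * exp (- 2 * (1 / (2 * s))\<^sup>2 * real (2 ^ r)) \<le> 2 ^ n * exp (- real n)"
      by simp
    moreover have "(2::real) ^ n < exp 1 ^ n"
      using n exp_lower_Taylor_quadratic[of 1] by (intro power_strict_mono) auto
    then have "2 ^ n * exp (- real n) < 1"
      by (simp add: exp_minus field_simps flip: exp_of_nat_mult)
    ultimately show ?thesis
      unfolding card_bitstrings of_nat_power of_nat_numeral by (rule le_less_trans)
  qed
  have "\<exists>F :: nat \<Rightarrow> _. (\<forall>j<2 ^ r. F j \<in> set_pmf D) \<and> (\<forall>x\<in>bitstrings n.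
      real (card {j. j < 2 ^ r \<and> F j \<in> bad x}) \<le> real (2 ^ r) * (1 / (2 * s) + 1 / (2 * s)))"
    using D s by (intro exists_good_samples small finite_bitstrings)
      (auto simp: threshold_pmf_def bad_def)
  then obtain F :: "nat \<Rightarrow> _" where F: "\<And>j. j < 2 ^ r \<Longrightarrow> F j \<in> set_pmf D"
    "\<And>x. x \<in> bitstrings n \<Longrightarrow> real (card {j. j < 2 ^ r \<and> F j \<in> bad x}) \<le>
      real (2 ^ r) * (1 / (2 * s) + 1 / (2 * s))"
    by blast
  have "real (card {j. j < 2 ^ r \<and> F j x \<noteq> of_bool (TH \<theta> x)}) \<le> 2 ^ r * (1 / s)"
    if "x \<in> bitstrings n" for x
    using F(2)[OF that] TH_conv_weight[OF that, of \<theta>] n s by (simp add: bad_def)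
  then have "\<exists>D :: 'a mpoly pmf. probabilistic_polynomial n (TH \<theta>) (1 / s) d D \<and> sampled_by_bits r D"
    using F(1) D by (intro probabilistic_polynomial_from_samples[of _ _ _ F])
      (auto simp: threshold_pmf_def)
  ultimately show ?thesis by blast
qed

text \<open>Serves the case \<open>n = 1\<close>, where \<open>ln n = 0\<close> forces the number of
  random bits to be 0.\<close>

lemma exists_exact_polynomial:
  assumes "0 < n" "0 \<le> \<epsilon>"
  shows "\<exists>D :: 'a::ring_1 mpoly pmf. probabilistic_polynomial n (TH \<theta>) \<epsilon> n D \<and> sampled_by_bits 0 D"
proof -
  obtain f where f: "multilinear n n f"
    "\<And>x. weight n x \<in> {0..0 + n} \<Longrightarrow> f x = of_bool (\<theta> * real n \<le> real (weight n x))"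
    using multilinear_weight_interpolation[of n n 0 "\<lambda>w. of_bool (\<theta> * real n \<le> real w)"] by auto
  then have "f x = of_bool (TH \<theta> x)" if "x \<in> bitstrings n" for x
    using TH_conv_weight[OF that assms(1)] weight_le by simp
  then show ?thesis
    using f(1) assms(2) by (intro probabilistic_polynomial_from_samples[of _ _ _ "\<lambda>_. f"]) auto
qed

theorem theorem1p1:
  shows "\<exists>C1 > 0. \<exists>C2 > 0. \<forall>\<theta>::real. \<forall>n::nat. \<forall>s::real.
    0 \<le> \<theta> \<longrightarrow> \<theta> \<le> 1 \<longrightarrow> n \<ge> 1 \<longrightarrow> s \<ge> 2 \<longrightarrow>
      (\<exists>(D :: 'a::ring_1 mpoly pmf) (d::nat) (r::nat).
         probabilistic_polynomial n (TH \<theta>) (1 / s) d D \<and>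
         real d \<le> C1 * sqrt (real n * ln s) \<and>
         sampled_by_bits r D \<and>
         real r \<le> C2 * (ln (real n) * ln (real n * s)))"
proof -
  have "\<exists>(D :: 'a mpoly pmf) d r.
      probabilistic_polynomial n (TH \<theta>) (1 / s) d D \<and> real d \<le> 120 * sqrt (real n * ln s) \<and>
      sampled_by_bits r D \<and> real r \<le> 4 / (ln 2)\<^sup>2 * (ln (real n) * ln (real n * s))"
    if ns: "n \<ge> 1" "s \<ge> 2" for \<theta> s :: real and n :: nat
  proof (cases "n = 1")
    case True
    obtain D :: "'a mpoly pmf" where
      D: "probabilistic_polynomial n (TH \<theta>) (1 / s) n D" "sampled_by_bits 0 D"
      using exists_exact_polynomial[where ?'a = 'a, of n "1 / s" \<theta>] ns by auto
    \<comment> \<open>From \<open>1 \<le> ln (8 * s) \<le> 4 * ln s\<close>; it makes the degree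
      bound at least 60, enough for degree 1.\<close>
    have "1 / 4 \<le> ln s"
      using ln_8_mult_le[OF ns(2)] ln_ge_iff[of "8 * s" 1] exp_le ns(2) by auto
    then have "1 / 2 \<le> sqrt (ln s)" by (intro real_le_rsqrt) (simp add: power2_eq_square)
    then have "real n \<le> 120 * sqrt (real n * ln s)" using True by simp
    then show ?thesis
      using D True by (intro exI[of _ D] exI[of _ n] exI[of _ 0]) simp
  next
    case False
    then show ?thesis using exists_probabilistic_polynomial[where ?'a = 'a, of n s \<theta>] ns by simp
  qed
  then show ?thesis
    by (intro exI[of _ 120] exI[of _ "4 / (ln 2)\<^sup>2"] conjI) auto
qed

end
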